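(* Let $m$ be a positive integer. In each of the following cases the displayed identity holds, and the triple consisting of $n_1=6m+5$ and the denominators $n_2,n_3$ of the second and third unit fractions on the right-hand side is a wild solution of the Erdős–Straus equation for $24m+1$. (1) If $m=19r-1+c(114r-1)$ with $r\in\mathbb N$, $r>0$, $c\in\mathbb N$, then $$\frac{4}{24m+1}=\frac{1}{6m+5}+\frac{1}{6r(6c+1)(24m+1)}+\frac{1}{6r(6c+1)(114r-1)(24m+1)}.$$ (2) If $m=95r+30+c(114r+37)$ with $r,c\in\mathbb N$, then $$\frac{4}{24m+1}=\frac{1}{6m+5}+\frac{1}{2(3r+1)(6c+5)(24m+1)}+\frac{1}{2(3r+1)(6c+5)(114r+37)(24m+1)}.$$
   Context: $\mathbb N$ denotes the set of nonnegative integers. For a positive integer $m$, the Erdős–Straus equation for $n=24m+1$ is $\frac{4}{n}=\frac1{n_1}+\frac1{n_2}+\frac1{n_3}$ in positive integers $n_1,n_2,n_3$. For $n_1=6m+k$ with $1\le k\le 12m$ one has $\frac{4}{24m+1}=\frac{1}{6m+k}+\frac{4k-1}{(6m+k)(24m+1)}$. A solution $(n_1,n_2,n_3)$ is called a wild solution if $n_1=6m+k$ for some integer $1\le k\le 12m$ and there exist an integer $L\ge 2$ (called a multiplier) and positive integers $J_1,J_2$ (called the numerator summands) such that $J_1+J_2=L(4k-1)$, $\gcd(L,J_1,J_2)=1$, $\frac1{n_2}=\frac{J_1}{L(6m+k)(24m+1)}$ and $\frac1{n_3}=\frac{J_2}{L(6m+k)(24m+1)}$. *)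

theory Defs
  imports Complex_Main
begin

definition erdos_straus_solution :: "int \<Rightarrow> int \<Rightarrow> int \<Rightarrow> int \<Rightarrow> bool" where
  "erdos_straus_solution n n1 n2 n3 \<longleftrightarrow>
     n1 > 0 \<and> n2 > 0 \<and> n3 > 0 \<and>
     4 / rat_of_int n = 1 / rat_of_int n1 + 1 / rat_of_int n2 + 1 / rat_of_int n3"

text \<open>
  Wild solutions of the equation for \<open>24 * m + 1\<close>, where \<open>m > 0\<close>.
  \<open>L\<close> is the multiplier and \<open>J1\<close>, \<open>J2\<close> are the numerator summands: they split the remainder
  \<open>4 / (24 * m + 1) - 1 / (6 * m + k) = (4 * k - 1) / ((6 * m + k) * (24 * m + 1))\<close>.
\<close>

definition wild_solution :: "int \<Rightarrow> int \<Rightarrow> int \<Rightarrow> int \<Rightarrow> bool" where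
  "wild_solution m n1 n2 n3 \<longleftrightarrow>
     erdos_straus_solution (24 * m + 1) n1 n2 n3 \<and>
     (\<exists>k L J1 J2 :: int.
        1 \<le> k \<and> k \<le> 12 * m \<and> n1 = 6 * m + k \<and>
        L \<ge> 2 \<and> J1 > 0 \<and> J2 > 0 \<and>
        J1 + J2 = L * (4 * k - 1) \<and>
        gcd L (gcd J1 J2) = 1 \<and>
        1 / rat_of_int n2 = rat_of_int J1 / rat_of_int (L * (6 * m + k) * (24 * m + 1)) \<and>
        1 / rat_of_int n3 = rat_of_int J2 / rat_of_int (L * (6 * m + k) * (24 * m + 1)))"

end

(* If L (4k - 1) - 1 divides 6m + k, splitting the numerator L (4k - 1) of the remainder as
   (L (4k - 1) - 1) + 1 gives a wild solution. In the theorem k = 5, so 4k - 1 = 19; the factor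
   19 L - 1 of 6m + 5 is 114 r - 1 with L = 6 r in case (1), and 114 r + 37 with
   L = 2 (3 r + 1) in case (2). *)
theory Submission
  imports Defs
begin

text \<open>With numerator summands \<open>d\<close> and 1, the factor \<open>d\<close> of
  \<open>6 * m + k = b * d\<close> cancels from the first fraction, and the second is already a unit
  fraction. The summand 1 makes the gcd condition automatic.\<close>

lemma wild_solution_of_factorization:
  fixes m k L b d :: int
  assumes m: "m > 0" and k: "1 \<le> k" "k \<le> 12 * m" and L: "L \<ge> 2" and b: "b > 0"
    and d: "d = L * (4 * k - 1) - 1" and fac: "6 * m + k = b * d"
  shows "wild_solution m (6 * m + k) (L * b * (24 * m + 1)) (L * b * d * (24 * m + 1))"
proof -
  have "0 < b * d"
    using fac m k by linarith
  then have d0: "d > 0"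
    using b by (simp add: zero_less_mult_iff)
  define N where "N = 24 * m + 1"
  have N0: "N > 0"
    using m by (simp add: N_def)
  \<comment> \<open>This is \<open>24 * m + 1 = 4 * (6 * m + k) - (4 * k - 1)\<close>.\<close>
  have N: "N = 4 * (b * d) - (4 * k - 1)"
    using fac by (simp add: N_def)
  have "L * N = 4 * (L * b * d) - L * (4 * k - 1)"
    unfolding N by (simp add: algebra_simps)
  \<comment> \<open>The three-fraction identity multiplied through by \<open>L * b * d * N\<close>;
    it uses \<open>L * (4 * k - 1) = d + 1\<close>.\<close>
  then have N_eq: "4 * (L * b * d) = L * N + d + 1"
    using d by linarith
  have nz: "rat_of_int L \<noteq> 0" "rat_of_int b \<noteq> 0" "rat_of_int d \<noteq> 0" "rat_of_int N \<noteq> 0"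
    using L b d0 N0 by auto
  have "4 * (rat_of_int L * rat_of_int b * rat_of_int d)
      = rat_of_int L * rat_of_int N + rat_of_int d + 1"
    using arg_cong[OF N_eq, of rat_of_int] by simp
  then have "4 / rat_of_int N = 1 / rat_of_int (b * d)
      + 1 / rat_of_int (L * b * N) + 1 / rat_of_int (L * b * d * N)"
    using nz by (simp add: field_simps)
  then have "erdos_straus_solution N (b * d) (L * b * N) (L * b * d * N)"
    using L b d0 N0 by (simp add: erdos_straus_solution_def)
  \<comment> \<open>Over the common denominator \<open>L * n1 * N\<close> with
    \<open>n1 = b * d\<close>, the numerators are \<open>d\<close> and 1.\<close>
  moreover have "1 / rat_of_int (L * b * N) = rat_of_int d / rat_of_int (L * (b * d) * N)"
    "1 / rat_of_int (L * b * d * N) = rat_of_int 1 / rat_of_int (L * (b * d) * N)"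
    using nz by (simp_all add: field_simps)
  moreover have "d + 1 = L * (4 * k - 1)" "gcd L (gcd d 1) = 1"
    using d by simp_all
  ultimately show ?thesis
    unfolding wild_solution_def fac N_def[symmetric] using k L d0 fac
    by (intro conjI exI[of _ k] exI[of _ L] exI[of _ d] exI[of _ 1]) auto
qed

theorem theorem3p5:
  fixes m :: int
  assumes "m > 0"
  shows "(\<forall>r c :: nat. r > 0 \<longrightarrow> m = 19 * int r - 1 + int c * (114 * int r - 1) \<longrightarrow>
            4 / rat_of_int (24 * m + 1)
              = 1 / rat_of_int (6 * m + 5)
                + 1 / rat_of_int (6 * int r * (6 * int c + 1) * (24 * m + 1))
                + 1 / rat_of_int (6 * int r * (6 * int c + 1) * (114 * int r - 1) * (24 * m + 1))
            \<and> wild_solution m (6 * m + 5)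
                (6 * int r * (6 * int c + 1) * (24 * m + 1))
                (6 * int r * (6 * int c + 1) * (114 * int r - 1) * (24 * m + 1)))
       \<and> (\<forall>r c :: nat. m = 95 * int r + 30 + int c * (114 * int r + 37) \<longrightarrow>
            4 / rat_of_int (24 * m + 1)
              = 1 / rat_of_int (6 * m + 5)
                + 1 / rat_of_int (2 * (3 * int r + 1) * (6 * int c + 5) * (24 * m + 1))
                + 1 / rat_of_int (2 * (3 * int r + 1) * (6 * int c + 5) * (114 * int r + 37) * (24 * m + 1))
            \<and> wild_solution m (6 * m + 5)
                (2 * (3 * int r + 1) * (6 * int c + 5) * (24 * m + 1))
                (2 * (3 * int r + 1) * (6 * int c + 5) * (114 * int r + 37) * (24 * m + 1)))"
proof -
  have case1: "wild_solution m (6 * m + 5)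
      (6 * int r * (6 * int c + 1) * (24 * m + 1))
      (6 * int r * (6 * int c + 1) * (114 * int r - 1) * (24 * m + 1))"
    if "r > 0" "m = 19 * int r - 1 + int c * (114 * int r - 1)" for r c :: nat
    \<comment> \<open>Since \<open>6 * (19 * r - 1) + 5 = 114 * r - 1\<close>, the cofactor of
      \<open>d = 114 * r - 1\<close> in \<open>6 * m + 5\<close> is
      \<open>b = 6 * c + 1\<close>.\<close>
    using that assms by (intro wild_solution_of_factorization) (auto simp: algebra_simps)
  have case2: "wild_solution m (6 * m + 5)
      (2 * (3 * int r + 1) * (6 * int c + 5) * (24 * m + 1))
      (2 * (3 * int r + 1) * (6 * int c + 5) * (114 * int r + 37) * (24 * m + 1))"
    if "m = 95 * int r + 30 + int c * (114 * int r + 37)" for r c :: nat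
    \<comment> \<open>Here \<open>6 * (95 * r + 30) + 5 = 5 * (114 * r + 37)\<close>, so
      \<open>b = 6 * c + 5\<close>; the multiplier is at least 2 already at
      \<open>r = 0\<close>.\<close>
    using that assms by (intro wild_solution_of_factorization) (auto simp: algebra_simps)
  have identity: "4 / rat_of_int (24 * m + 1)
      = 1 / rat_of_int n1 + 1 / rat_of_int n2 + 1 / rat_of_int n3"
    if "wild_solution m n1 n2 n3" for n1 n2 n3
    using that unfolding wild_solution_def erdos_straus_solution_def by blast
  show ?thesis
    using case1 case2 identity by blast
qed

end
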